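(* Let $K$ be a nonnegative integer, $\alpha\in\mathbb{R}$ a stepsize and $\beta\in\mathbb{R}$ a momentum parameter. Let $x^{(K)}$ denote the output after $K$ iterations of the heavy ball method $x^{(k+1)} = x^{(k)} - \alpha \nabla g(x^{(k)}) + \beta(x^{(k)} - x^{(k-1)})$ from given starting values $x^{(0)},x^{(-1)}\in\mathbb{R}^d$, and let $\Phi(x) = \frac12 x^T A(x^{(K)}) x - \nabla f(x^{(K)})^T x$ for $x\in\mathbb{R}^d$. Let $h^{(K)}\in\mathbb{R}^n$ be the gradient estimate obtained after $K$ iterations of the inexact automatic differentiation iteration $$h^{(k+1)} = h^{(k)} - \alpha B(x^{(K)})^T \tilde{x}^{(k)}, \qquad \tilde{x}^{(k+1)} = \tilde{x}^{(k)} - \alpha A(x^{(K)}) \tilde{x}^{(k)} + \beta(\tilde{x}^{(k)} - \tilde{x}^{(k-1)}), \qquad k=0,\dots,K-1,$$ initialized with $\tilde{x}^{(0)} = \nabla f(x^{(K)})$, $\tilde{x}^{(-1)} = 0$ and $h^{(0)} = 0$. Then $$h^{(K)} = -B(x^{(K)})^T q^{(K)},$$ where $q^{(0)} = q^{(-1)} = 0\in\mathbb{R}^d$ and $$q^{(k+1)} = q^{(k)} - \alpha \nabla \Phi(q^{(k)}) + \beta(q^{(k)} - q^{(k-1)}), \qquad k=0,1,\dots,K-1.$$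
   Context: Setting: $g:\mathbb{R}^d\times\mathbb{R}^n\to\mathbb{R}$, $(y,\theta)\mapsto g(y,\theta)$, is the lower-level objective of a bilevel problem, twice continuously differentiable in $y$ and such that the mixed derivative below exists; $f:\mathbb{R}^d\to\mathbb{R}$ is a differentiable upper-level function. The parameter $\theta\in\mathbb{R}^n$ is fixed and dropped from the notation: $\nabla g(y) := \partial_y g(y,\theta)\in\mathbb{R}^d$ is the gradient in $y$; $A(y) := \partial_{yy} g(y,\theta)\in\mathbb{R}^{d\times d}$ is the (symmetric) Hessian in $y$; and $B(y) := \partial_y\partial_\theta g(y,\theta)\in\mathbb{R}^{d\times n}$ is the Jacobian of $\partial_y g$ with respect to $\theta$, i.e. $[B(y)]_{j,k} = \partial^2 g(y,\theta)/(\partial y_j\partial\theta_k)$. *)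

theory Defs
  imports "HOL-Analysis.Analysis"
begin

definition gradient :: "('a::real_inner \<Rightarrow> real) \<Rightarrow> 'a \<Rightarrow> 'a" where
  "gradient F x = (THE D. GDERIV F x :> D)"

lemma gradient_eqI:
  assumes "GDERIV F x :> D"
  shows "gradient F x = D"
  unfolding gradient_def
proof (rule the_equality)
  show "GDERIV F x :> D" by fact
next
  fix D' assume "GDERIV F x :> D'"
  then have "(\<lambda>h. inner h D') = (\<lambda>h. inner h D)"
    using assms has_derivative_unique unfolding gderiv_def by blast
  then show "D' = D"
    using vector_eq_ldot[of D' D] by (auto dest: fun_cong)
qed

lemma gradient_works:
  fixes F :: "'a::euclidean_space \<Rightarrow> real"
  assumes "F differentiable (at x)"
  shows "GDERIV F x :> gradient F x"
proof -
  from assms obtain F' where F': "(F has_derivative F') (at x)"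
    by (auto simp: differentiable_def)
  then interpret bounded_linear F' by (rule has_derivative_bounded_linear)
  have "inner h (adjoint F' 1) = F' h" for h
    using adjoint_works[OF linear_axioms, of h 1] by simp
  then have "F' = (\<lambda>h. inner h (adjoint F' 1))"
    by presburger
  with F' have "GDERIV F x :> adjoint F' 1"
    by (simp add: gderiv_def)
  then show ?thesis
    by (simp add: gradient_eqI)
qed

definition hessian :: "(real ^ 'd \<Rightarrow> real) \<Rightarrow> real ^ 'd \<Rightarrow> real ^ 'd ^ 'd" where
  "hessian F y = jacobian (gradient F) (at y)"

definition twice_continuously_differentiable :: "(real ^ 'd \<Rightarrow> real) \<Rightarrow> bool" where
  "twice_continuously_differentiable F \<longleftrightarrow>
     (\<forall>y. F differentiable (at y)) \<and>
     (\<forall>y. gradient F differentiable (at y)) \<and>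
     continuous_on UNIV (hessian F)"

(* The gradient in y, at the parameter obtained by moving a distance s from theta in the k-th
   coordinate direction; its j-th component, differentiated at s = 0, is the (j,k) entry of the
   Jacobian with respect to theta of the gradient in y.  Only existence of these partial
   derivatives is required; under Frechet differentiability the matrix below is the library
   Jacobian, see mixed_hessian_eq_jacobian. *)
definition grad_along_param ::
  "(real ^ 'd \<Rightarrow> real ^ 'n \<Rightarrow> real) \<Rightarrow> real ^ 'd \<Rightarrow> real ^ 'n \<Rightarrow> 'n \<Rightarrow> real \<Rightarrow> real ^ 'd" where
  "grad_along_param g y \<theta> k s = gradient (\<lambda>z. g z (\<theta> + s *\<^sub>R axis k 1)) y"

definition mixed_hessian_exists ::
  "(real ^ 'd \<Rightarrow> real ^ 'n \<Rightarrow> real) \<Rightarrow> real ^ 'd \<Rightarrow> real ^ 'n \<Rightarrow> bool" where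
  "mixed_hessian_exists g y \<theta> \<longleftrightarrow>
     (\<forall>j k. (\<lambda>s. grad_along_param g y \<theta> k s $ j) field_differentiable (at 0))"

definition mixed_hessian ::
  "(real ^ 'd \<Rightarrow> real ^ 'n \<Rightarrow> real) \<Rightarrow> real ^ 'd \<Rightarrow> real ^ 'n \<Rightarrow> real ^ 'n ^ 'd" where
  "mixed_hessian g y \<theta> = (\<chi> j k. deriv (\<lambda>s. grad_along_param g y \<theta> k s $ j) 0)"

lemma mixed_hessian_eq_jacobian:
  fixes g :: "real ^ 'd \<Rightarrow> real ^ 'n \<Rightarrow> real"
  assumes "(\<lambda>t. gradient (\<lambda>z. g z t) y) differentiable (at \<theta>)"
  shows "mixed_hessian_exists g y \<theta>"
    and "mixed_hessian g y \<theta> = jacobian (\<lambda>t. gradient (\<lambda>z. g z t) y) (at \<theta>)"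
proof -
  define G where "G = (\<lambda>t. gradient (\<lambda>z. g z t) y)"
  define J where "J = jacobian G (at \<theta>)"
  have G': "(G has_derivative (\<lambda>h. J *v h)) (at \<theta>)"
    using assms jacobian_works[of G "at \<theta>"] by (simp add: G_def J_def)
  have D: "((\<lambda>s. grad_along_param g y \<theta> k s $ j) has_field_derivative J $ j $ k) (at 0)" for j k
  proof -
    have "((\<lambda>s::real. \<theta> + s *\<^sub>R axis k 1) has_derivative (\<lambda>s. s *\<^sub>R axis k 1)) (at 0)"
      by (auto intro!: derivative_eq_intros)
    then have "((\<lambda>s. G (\<theta> + s *\<^sub>R axis k 1)) has_derivative (\<lambda>s. J *v (s *\<^sub>R axis k 1))) (at 0)"
      using has_derivative_compose[of "\<lambda>s::real. \<theta> + s *\<^sub>R axis k 1" _ 0 UNIV G "\<lambda>h. J *v h"] G'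
      by simp
    then have "((\<lambda>s. G (\<theta> + s *\<^sub>R axis k 1) $ j) has_derivative
        (\<lambda>s. (J *v (s *\<^sub>R axis k 1)) $ j)) (at 0)"
      by (rule bounded_linear.has_derivative[OF bounded_linear_vec_nth])
    moreover have "(J *v (s *\<^sub>R axis k 1)) $ j = J $ j $ k * s" for s
      by (simp add: matrix_vector_mult_scaleR matrix_vector_mult_basis column_def)
    ultimately show ?thesis
      by (simp add: has_field_derivative_def G_def grad_along_param_def)
  qed
  show "mixed_hessian_exists g y \<theta>"
    unfolding mixed_hessian_exists_def field_differentiable_def using D by blast
  show "mixed_hessian g y \<theta> = jacobian (\<lambda>t. gradient (\<lambda>z. g z t) y) (at \<theta>)"
    by (simp add: mixed_hessian_def vec_eq_iff DERIV_imp_deriv[OF D] J_def G_def)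
qed

end

theory Submission
  imports Defs
begin

text \<open>The quadratic model has gradient \<open>A q - c\<close> with \<open>c = gradient f (x (int K))\<close>, because the
  Hessian is symmetric (both mixed second derivatives are the limit of the same second difference
  quotient). Induction on \<open>k\<close> then gives \<open>q k - q (k - 1) = \<alpha> *\<^sub>R xt (k - 1)\<close> together
  with \<open>xt k = c - A q k + \<beta> *\<^sub>R xt (k - 1)\<close>: the backward iterates, scaled by \<open>\<alpha>\<close>, are the
  increments of the heavy ball iterates \<open>q\<close>, so that \<open>h\<close>, which accumulates them, telescopes.\<close>

text \<open>The mean value theorem along \<open>u\<close>, applied to the increment of
  \<open>F\<close> along \<open>v\<close>, turns the second difference into \<open>t\<close> times a
  difference of two values of \<open>G\<close>. Linearising both values at \<open>x\<close> leaves
  \<open>t *\<^sub>R L v\<close> up to an error of order o(t).\<close>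

lemma second_difference_tendsto:
  fixes F :: "'a::real_inner \<Rightarrow> real"
  assumes F: "\<And>y. GDERIV F y :> G y"
    and G: "(G has_derivative L) (at x)"
  shows "((\<lambda>t. (F (x + t *\<^sub>R u + t *\<^sub>R v) - F (x + t *\<^sub>R u) - F (x + t *\<^sub>R v) + F x) / t\<^sup>2)
    \<longlongrightarrow> u \<bullet> L v) (at_right 0)"
proof (rule tendstoI)
  fix e :: real assume "e > 0"
  \<comment> \<open>\<open>M\<close> bounds \<open>norm u\<close> and, multiplied by
    \<open>t\<close>, every displacement from \<open>x\<close> used below; the summand 1 keeps it
    positive, so that \<open>t < d / M\<close> places these displacements inside the radius
    \<open>d\<close>.\<close>
  define M where "M = norm u + norm v + 1"
  have M: "M \<ge> 1" "norm u \<le> M" "norm u + norm v \<le> M" by (auto simp: M_def)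
  \<comment> \<open>Two linearisation errors of size \<open>c * (t * M)\<close>, paired with
    \<open>u\<close> and divided by \<open>t\<close>, contribute at most
    \<open>2 * c * M * M\<close>, which this choice makes \<open>e / 2\<close>.\<close>
  define c where "c = e / (4 * M * M)"
  have "c > 0" using \<open>e > 0\<close> M by (simp add: c_def)
  then obtain d where "d > 0"
    and d: "\<And>y. norm (y - x) < d \<Longrightarrow> norm (G y - G x - L (y - x)) \<le> c * norm (y - x)"
    using G unfolding has_derivative_at_alt by blast
  interpret L: bounded_linear L using G by (rule has_derivative_bounded_linear)
  let ?D = "\<lambda>t. F (x + t *\<^sub>R u + t *\<^sub>R v) - F (x + t *\<^sub>R u) - F (x + t *\<^sub>R v) + F x"
  have "dist (?D t / t\<^sup>2) (u \<bullet> L v) < e" if "0 < t" "t < d / M" for t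
  proof -
    have tM: "t * M < d" using that M by (simp add: field_simps)
    have near: "norm (G (x + w) - G x - L w) \<le> c * (t * M)" if "norm w \<le> t * M" for w
    proof -
      have "norm (G (x + w) - G x - L w) \<le> c * norm w" using d[of "x + w"] that tM by simp
      also have "\<dots> \<le> c * (t * M)" using that \<open>c > 0\<close> by simp
      finally show ?thesis .
    qed
    define p where "p = (\<lambda>s. F (x + s *\<^sub>R u + t *\<^sub>R v) - F (x + s *\<^sub>R u))"
    have line: "((\<lambda>s. F (y + s *\<^sub>R u)) has_real_derivative u \<bullet> G (y + s *\<^sub>R u)) (at s)" for y s
    proof -
      have "((\<lambda>s. y + s *\<^sub>R u) has_derivative (\<lambda>h. h *\<^sub>R u)) (at s)"
        by (auto intro!: derivative_eq_intros)
      from has_derivative_compose[OF this F[unfolded gderiv_def]]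
      show ?thesis by (simp add: has_field_derivative_def mult_commute_abs)
    qed
    have "(p has_real_derivative u \<bullet> (G (x + s *\<^sub>R u + t *\<^sub>R v) - G (x + s *\<^sub>R u))) (at s)" for s
      using DERIV_diff[OF line[of "x + t *\<^sub>R v" s] line[of x s]]
      by (simp add: p_def inner_diff_right add.commute add.left_commute)
    from MVT2[OF \<open>0 < t\<close> this] obtain s where s: "0 < s" "s < t"
      and ps: "p t - p 0 = t * (u \<bullet> (G (x + s *\<^sub>R u + t *\<^sub>R v) - G (x + s *\<^sub>R u)))" by auto
    \<comment> \<open>Both errors are measured from the base point \<open>x\<close>, where
      \<open>G\<close> has the derivative \<open>L\<close>. In the difference the terms
      \<open>L (s *\<^sub>R u)\<close> cancel, so the unknown intermediate point \<open>s\<close>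
      drops out of the main term.\<close>
    define a where "a = G (x + (s *\<^sub>R u + t *\<^sub>R v)) - G x - L (s *\<^sub>R u + t *\<^sub>R v)"
    define b where "b = G (x + s *\<^sub>R u) - G x - L (s *\<^sub>R u)"
    have su: "norm (s *\<^sub>R u) \<le> t * norm u" using s by (simp add: mult_right_mono)
    have "t * norm u + t * norm v \<le> t * M" using \<open>0 < t\<close> M(3)
      by (simp flip: distrib_left)
    moreover have "norm (t *\<^sub>R v) = t * norm v" "0 \<le> t * norm v" using \<open>0 < t\<close> by auto
    ultimately have "norm (s *\<^sub>R u + t *\<^sub>R v) \<le> t * M" "norm (s *\<^sub>R u) \<le> t * M"
      using su norm_triangle_ineq[of "s *\<^sub>R u" "t *\<^sub>R v"] by linarith+
    then have ab: "norm a \<le> c * (t * M)" "norm b \<le> c * (t * M)"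
      unfolding a_def b_def by (auto intro: near)
    have "G (x + s *\<^sub>R u + t *\<^sub>R v) - G (x + s *\<^sub>R u) = t *\<^sub>R L v + (a - b)"
      by (simp add: a_def b_def L.add L.scaleR add.assoc)
    moreover have "?D t = p t - p 0" by (simp add: p_def algebra_simps)
    ultimately have "?D t = t\<^sup>2 * (u \<bullet> L v) + t * (u \<bullet> (a - b))"
      using ps by (simp only: inner_add_right inner_scaleR_right distrib_left power2_eq_square mult.assoc)
    then have "?D t / t\<^sup>2 - u \<bullet> L v = (t\<^sup>2 * (u \<bullet> L v) + t * (u \<bullet> (a - b))) / t\<^sup>2 - u \<bullet> L v"
      by (simp only:)
    also have "\<dots> = (u \<bullet> (a - b)) / t"
      using \<open>0 < t\<close> by (simp add: add_divide_distrib power2_eq_square)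
    finally have "?D t / t\<^sup>2 - u \<bullet> L v = (u \<bullet> (a - b)) / t" .
    then have "dist (?D t / t\<^sup>2) (u \<bullet> L v) = \<bar>u \<bullet> (a - b)\<bar> / t"
      using \<open>0 < t\<close> by (simp add: dist_real_def)
    also have "\<bar>u \<bullet> (a - b)\<bar> \<le> norm u * norm (a - b)" by (rule Cauchy_Schwarz_ineq2)
    also have "\<dots> \<le> M * (2 * (c * (t * M)))"
      using M ab norm_triangle_ineq4[of a b] by (intro mult_mono) auto
    also have "M * (2 * (c * (t * M))) / t = e / 2"
      using \<open>0 < t\<close> M by (simp add: c_def)
    also have "\<dots> < e" using \<open>e > 0\<close> by simp
    finally show ?thesis using \<open>0 < t\<close> by (simp add: divide_right_mono)
  qed
  moreover have "0 < d / M" using \<open>d > 0\<close> M by simp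
  ultimately show "\<forall>\<^sub>F t in at_right 0. dist (?D t / t\<^sup>2) (u \<bullet> L v) < e"
    unfolding eventually_at_right_field by blast
qed

text \<open>Exchanging \<open>u\<close> and \<open>v\<close> does not change the second difference,
  so its two limits coincide.\<close>

lemma derivative_of_gradient_symmetric:
  fixes F :: "'a::real_inner \<Rightarrow> real"
  assumes "\<And>y. GDERIV F y :> G y" and "(G has_derivative L) (at x)"
  shows "u \<bullet> L v = v \<bullet> L u"
proof (rule tendsto_unique)
  show "((\<lambda>t. (F (x + t *\<^sub>R u + t *\<^sub>R v) - F (x + t *\<^sub>R u) - F (x + t *\<^sub>R v) + F x) / t\<^sup>2)
    \<longlongrightarrow> u \<bullet> L v) (at_right 0)"
    using assms by (rule second_difference_tendsto)
  show "((\<lambda>t. (F (x + t *\<^sub>R u + t *\<^sub>R v) - F (x + t *\<^sub>R u) - F (x + t *\<^sub>R v) + F x) / t\<^sup>2)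
    \<longlongrightarrow> v \<bullet> L u) (at_right 0)"
    using second_difference_tendsto[OF assms, of v u] by (simp add: algebra_simps)
qed simp

lemma hessian_symmetric:
  assumes "twice_continuously_differentiable F"
  shows "u \<bullet> (hessian F y *v v) = v \<bullet> (hessian F y *v u)"
proof (rule derivative_of_gradient_symmetric)
  show "GDERIV F z :> gradient F z" for z
    using assms by (simp add: twice_continuously_differentiable_def gradient_works)
  show "(gradient F has_derivative (*v) (hessian F y)) (at y)"
    using assms jacobian_works[of "gradient F" "at y"]
    by (simp add: twice_continuously_differentiable_def hessian_def)
qed

text \<open>The product rule gives two terms, with \<open>H\<close> acting on the increment and on
  the point; symmetry makes them equal, which absorbs the factor 1/2.\<close>

lemma gradient_quadratic:
  fixes H :: "real ^ 'd ^ 'd"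
  assumes "\<And>u v. u \<bullet> (H *v v) = v \<bullet> (H *v u)"
  shows "gradient (\<lambda>z. 1 / 2 * (z \<bullet> (H *v z)) - c \<bullet> z) y = H *v y - c"
proof (rule gradient_eqI)
  have [derivative_intros]: "((*v) H has_derivative (*v) H) (at y)"
    by (simp add: bounded_linear_imp_has_derivative)
  show "GDERIV (\<lambda>z. 1 / 2 * (z \<bullet> (H *v z)) - c \<bullet> z) y :> H *v y - c"
    unfolding gderiv_def
  proof (rule has_derivative_eq_rhs)
    show "((\<lambda>z. 1 / 2 * (z \<bullet> (H *v z)) - c \<bullet> z) has_derivative
        (\<lambda>h. 1 / 2 * (y \<bullet> (H *v h) + h \<bullet> (H *v y)) - c \<bullet> h)) (at y)"
      by (rule derivative_eq_intros refl)+ simp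
    show "(\<lambda>h. 1 / 2 * (y \<bullet> (H *v h) + h \<bullet> (H *v y)) - c \<bullet> h) = (\<lambda>h. h \<bullet> (H *v y - c))"
    proof
      fix h
      show "1 / 2 * (y \<bullet> (H *v h) + h \<bullet> (H *v y)) - c \<bullet> h = h \<bullet> (H *v y - c)"
        unfolding assms[of y h] by (simp add: inner_diff_right inner_commute)
    qed
  qed
qed

theorem theorem8:
  fixes g :: "real ^ 'd \<Rightarrow> real ^ 'n \<Rightarrow> real"
    and f :: "real ^ 'd \<Rightarrow> real"
    and \<theta> :: "real ^ 'n"
    and A :: "real ^ 'd \<Rightarrow> real ^ 'd ^ 'd"
    and B :: "real ^ 'd \<Rightarrow> real ^ 'n ^ 'd"
    and K :: nat
    and \<alpha> \<beta> :: real
    and x xt q :: "int \<Rightarrow> real ^ 'd"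
    and h :: "int \<Rightarrow> real ^ 'n"
    and \<Phi> :: "real ^ 'd \<Rightarrow> real"
  assumes g_C2: "\<And>t. twice_continuously_differentiable (\<lambda>y. g y t)"
    and g_mixed: "\<And>y. mixed_hessian_exists g y \<theta>"
    and f_diff: "\<And>y. f differentiable (at y)"
    and A: "\<And>y. A y = hessian (\<lambda>z. g z \<theta>) y"
    and B: "\<And>y. B y = mixed_hessian g y \<theta>"
    and x_step: "\<And>k. 0 \<le> k \<Longrightarrow> k < int K \<Longrightarrow>
      x (k + 1) = x k - \<alpha> *\<^sub>R gradient (\<lambda>y. g y \<theta>) (x k) + \<beta> *\<^sub>R (x k - x (k - 1))"
    and Phi: "\<And>z. \<Phi> z = 1 / 2 * (z \<bullet> (A (x (int K)) *v z)) - gradient f (x (int K)) \<bullet> z"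
    and xt_init: "xt 0 = gradient f (x (int K))" "xt (-1) = 0"
    and h_init: "h 0 = 0"
    and h_step: "\<And>k. 0 \<le> k \<Longrightarrow> k < int K \<Longrightarrow>
      h (k + 1) = h k - \<alpha> *\<^sub>R (transpose (B (x (int K))) *v xt k)"
    and xt_step: "\<And>k. 0 \<le> k \<Longrightarrow> k < int K \<Longrightarrow>
      xt (k + 1) = xt k - \<alpha> *\<^sub>R (A (x (int K)) *v xt k) + \<beta> *\<^sub>R (xt k - xt (k - 1))"
    and q_init: "q 0 = 0" "q (-1) = 0"
    and q_step: "\<And>k. 0 \<le> k \<Longrightarrow> k < int K \<Longrightarrow>
      q (k + 1) = q k - \<alpha> *\<^sub>R gradient \<Phi> (q k) + \<beta> *\<^sub>R (q k - q (k - 1))"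
  shows "h (int K) = - (transpose (B (x (int K))) *v q (int K))"
proof -
  define c where "c = gradient f (x (int K))"
  define H where "H = A (x (int K))"
  define T where "T = transpose (B (x (int K)))"
  have sym: "u \<bullet> (H *v v) = v \<bullet> (H *v u)" for u v
    unfolding H_def A using g_C2 by (rule hessian_symmetric)
  have Phi': "\<Phi> = (\<lambda>z. 1 / 2 * (z \<bullet> (H *v z)) - c \<bullet> z)"
    by (simp add: fun_eq_iff Phi H_def c_def)
  have grad: "gradient \<Phi> z = H *v z - c" for z
    unfolding Phi' by (rule gradient_quadratic) (rule sym)
  have q': "q (int k + 1) = q (int k) - \<alpha> *\<^sub>R (H *v q (int k) - c) + \<beta> *\<^sub>R (q (int k) - q (int k - 1))"
    if "k < K" for k
    using q_step[of "int k"] that by (simp add: grad)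
  have xt': "xt (int k + 1) = xt (int k) - \<alpha> *\<^sub>R (H *v xt (int k)) + \<beta> *\<^sub>R (xt (int k) - xt (int k - 1))"
    if "k < K" for k
    using xt_step[of "int k"] that by (simp add: H_def)
  \<comment> \<open>The index is shifted by one so that the base case is about the starting values
    at -1: there both increments and momentum vanish, and \<open>xt 0\<close> is \<open>c\<close>.
    The second conjunct identifies the bracket that appears when \<open>\<alpha>\<close> is factored
    out of a step of \<open>q\<close>.\<close>
  have inv: "q (int k) - q (int k - 1) = \<alpha> *\<^sub>R xt (int k - 1) \<and>
      xt (int k) = c - H *v q (int k) + \<beta> *\<^sub>R xt (int k - 1)" if "k \<le> K" for k
    using that
  proof (induction k)
    case 0
    then show ?case by (simp add: q_init xt_init c_def)
  next
    case (Suc k)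
    then have "k < K" and dq: "q (int k) - q (int k - 1) = \<alpha> *\<^sub>R xt (int k - 1)"
      and xt: "xt (int k) = c - H *v q (int k) + \<beta> *\<^sub>R xt (int k - 1)" by auto
    have "q (int k + 1) - q (int k) = \<alpha> *\<^sub>R (c - H *v q (int k) + \<beta> *\<^sub>R xt (int k - 1))"
      unfolding q'[OF \<open>k < K\<close>] dq by (simp add: algebra_simps)
    then have dq': "q (int k + 1) - q (int k) = \<alpha> *\<^sub>R xt (int k)"
      by (simp only: xt)
    then have "H *v q (int k + 1) = H *v q (int k) + \<alpha> *\<^sub>R (H *v xt (int k))"
      by (metis add.commute diff_add_cancel matrix_vector_mult_scaleR matrix_vector_right_distrib)
    \<comment> \<open>Solving the second conjunct for the momentum term removes
      \<open>xt (int k - 1)\<close> from the recursion. The copies of \<open>xt (int k)\<close> then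
      cancel, and the previous equation merges the \<open>H\<close> terms into
      \<open>H *v q (int k + 1)\<close>, with no division by \<open>\<alpha>\<close> or
      \<open>\<beta>\<close>.\<close>
    moreover have "\<beta> *\<^sub>R xt (int k - 1) = xt (int k) - c + H *v q (int k)"
      using xt by (simp add: algebra_simps)
    ultimately have "xt (int k + 1) = c - H *v q (int k + 1) + \<beta> *\<^sub>R xt (int k)"
      unfolding xt'[OF \<open>k < K\<close>] scaleR_diff_right by simp
    with dq' show ?case by (simp add: add.commute)
  qed
  have "h (int k) = - (T *v q (int k))" if "k \<le> K" for k
    using that
  proof (induction k)
    case 0
    then show ?case by (simp add: h_init q_init)
  next
    case (Suc k)
    then have "q (int k + 1) - q (int k) = \<alpha> *\<^sub>R xt (int k)"
      \<comment> \<open>At \<open>Suc k\<close> the first conjunct is the increment of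
        \<open>q\<close> that matches the update of \<open>h\<close> from \<open>k\<close> to
        \<open>k + 1\<close>.\<close>
      using inv[of "Suc k"] by (simp add: add.commute)
    then have "T *v q (int k + 1) = T *v q (int k) + \<alpha> *\<^sub>R (T *v xt (int k))"
      by (metis add.commute diff_add_cancel matrix_vector_mult_scaleR matrix_vector_right_distrib)
    with Suc h_step[of "int k"] show ?case by (simp add: T_def add.commute)
  qed
  then show ?thesis by (simp add: T_def)
qed

end
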